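(* Let $h_\ell(x)$ and $\tilde h_{\ell,\boldsymbol{b}}(x)$ denote the full-precision and quantized hidden states at layer $\ell$ of an $L$-layer network on input $x$, where $\boldsymbol{b}=\{b_\ell\}_{\ell=1}^L$ is the bit allocation. Suppose that, for $\ell=1,\dots,L$, the layer-wise distortion satisfies $$\|\tilde h_{\ell,\boldsymbol{b}}(x)-h_\ell(x)\|\le \gamma_{\ell-1}\,\|\tilde h_{\ell-1,\boldsymbol{b}}(x)-h_{\ell-1}(x)\|+\varepsilon_\ell(b_\ell),$$ where $\varepsilon_\ell(b_\ell)$ denotes the local distortion introduced at layer $\ell$, $\gamma_{\ell-1}$ captures the sensitivity from layer $\ell-1$ to layer $\ell$, and the input distortion is initialized as $\|\tilde h_{0,\boldsymbol{b}}(x)-h_0(x)\|=0$. Then for any realized stopping depth $k$, the accumulated representation error satisfies $$\|\tilde h_{k,\boldsymbol{b}}(x)-h_k(x)\|\le\sum_{\ell=1}^{k}\varepsilon_\ell(b_\ell)\prod_{r=\ell+1}^{k}\gamma_{r-1},$$ where the empty product is defined as $1$. Under early exiting with random stopping depth $K_{\boldsymbol{\phi}}(x)$, the expected distortion satisfies $$\mathbb{E}_{x\sim\mathcal{D}}\left[\|\tilde h_{K_{\boldsymbol{\phi}}(x),\boldsymbol{b}}(x)-h_{K_{\boldsymbol{\phi}}(x)}(x)\|\right]\le\mathbb{E}_{x\sim\mathcal{D}}\left[\sum_{\ell=1}^{K_{\boldsymbol{\phi}}(x)}\varepsilon_\ell(b_\ell)\prod_{r=\ell+1}^{K_{\bo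ldsymbol{\phi}}(x)}\gamma_{r-1}\right].$$
   Context: The input $x$ is drawn from a data distribution $\mathcal{D}$; $\|\cdot\|$ is a norm on hidden states, and $h_0(x)$, $\tilde h_{0,\boldsymbol{b}}(x)$ are the full-precision and quantized inputs to the first layer. Each layer $\ell$ is quantized to bit-width $b_\ell$. The quantities $\gamma_{\ell-1}$ (local error amplification factors) and $\varepsilon_\ell(b_\ell)$ (local quantization error bounds) are written without dependence on $x$. The exit policy is a vector of thresholds $\boldsymbol{\phi}=\{\phi_\ell\}_{\ell=1}^L$ with $\phi_\ell\in[0,1]$. With exit confidences $\rho_\ell(x)$ (the maximal softmax probability of the logits at layer $\ell$), the stopping depth $K_{\boldsymbol{\phi}}(x)\in\{1,\dots,L\}$ is the first layer $\ell$ with $\rho_\ell(x)\ge\phi_\ell$, and equals $L$ if there is no such layer; it is random as a function of $x\sim\mathcal{D}$.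
   Formalization: The sensitivities γ_1,…,γ_{L-1} are assumed nonnegative; without this the claim fails (L=2, γ_1=-1, ε_1=ε_2=1, layer distortions 0, 0, 1). The hidden states and logits are assumed measurable so that the expectations make sense. *)

theory Defs
  imports "HOL-Probability.Probability"
begin

definition softmax :: "real ^ 'c \<Rightarrow> real ^ 'c" where
  "softmax z = (\<chi> i. exp (z $ i) / (\<Sum>j\<in>UNIV. exp (z $ j)))"

definition exit_confidence :: "real ^ 'c \<Rightarrow> real" where
  "exit_confidence z = Max (range (\<lambda>i. softmax z $ i))"

definition stopping_depth :: "nat \<Rightarrow> (nat \<Rightarrow> real) \<Rightarrow> (nat \<Rightarrow> 'x \<Rightarrow> real ^ 'c) \<Rightarrow> 'x \<Rightarrow> nat" where
  "stopping_depth L \<phi> logits x =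
     (if \<exists>l\<in>{1..L}. exit_confidence (logits l x) \<ge> \<phi> l
      then (LEAST l. l \<in> {1..L} \<and> exit_confidence (logits l x) \<ge> \<phi> l)
      else L)"

end

theory Submission
  imports Defs
begin

text \<open>Fix an input. The layer errors obey a linear recursion with zero start, so unrolling it
  (\<open>discrete_gronwall\<close>) bounds the error at each depth by the sum of local errors, each
  multiplied by the later amplification factors. This holds at every depth in \<open>{1..L}\<close>,
  hence at the depth selected for that input (\<open>stopping_depth_in_range\<close>). The bound
  depends on the input only through the depth, so once the depth is measurable
  (\<open>measurable_stopping_depth\<close>) the bound is a bounded random variable, and the
  pointwise inequality can be integrated.\<close>

lemma discrete_gronwall:
  fixes e c a :: "nat \<Rightarrow> real"
  assumes step: "\<And>l. l \<in> {1..k} \<Longrightarrow> e l \<le> c (l - 1) * e (l - 1) + a l"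
    and nonneg: "\<And>l. l \<in> {1..<k} \<Longrightarrow> 0 \<le> c l"
    and init: "e 0 = 0"
  shows "e k \<le> (\<Sum>l=1..k. a l * (\<Prod>r=l+1..k. c (r - 1)))"
  using step nonneg
proof (induction k)
  case 0
  then show ?case by (simp add: init)
next
  case (Suc k)
  let ?S = "\<lambda>k. \<Sum>l=1..k. a l * (\<Prod>r=l+1..k. c (r - 1))"
  have IH: "e k \<le> ?S k"
    using Suc by simp
  have "c k * e k \<le> c k * ?S k"
  proof (cases "k = 0")
    case True
    then show ?thesis by (simp add: init)
  next
    case False
    then show ?thesis using IH Suc.prems(2)[of k] by (intro mult_left_mono) auto
  qed
  moreover have "?S (Suc k) = c k * ?S k + a (Suc k)"
  proof -
    \<comment> \<open>Each product with l \<le> k gains just the factor at r = \<open>Suc k\<close>,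
      namely \<open>c k\<close>; the new summand l = \<open>Suc k\<close> has an empty
      product.\<close>
    have "(\<Sum>l=1..k. a l * (\<Prod>r=l+1..Suc k. c (r - 1))) = c k * ?S k"
      unfolding sum_distrib_left by (intro sum.cong refl) simp
    then show ?thesis by simp
  qed
  moreover have "e (Suc k) \<le> c k * e k + a (Suc k)"
    using Suc.prems(1)[of "Suc k"] by simp
  ultimately show ?case by linarith
qed

lemma borel_measurable_exit_confidence [measurable]:
  "(exit_confidence :: real ^ 'c \<Rightarrow> real) \<in> borel_measurable borel"
proof -
  have "(\<lambda>z :: real ^ 'c. softmax z $ i) \<in> borel_measurable borel" for i
    unfolding softmax_def
    by simp
  then show ?thesis
    unfolding exit_confidence_def by (intro borel_measurable_Max) auto
qed

lemma stopping_depth_in_range: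
  assumes "L \<ge> 1"
  shows "stopping_depth L \<phi> logits x \<in> {1..L}"
proof (cases "\<exists>l\<in>{1..L}. exit_confidence (logits l x) \<ge> \<phi> l")
  case True
  then have "\<exists>l. l \<in> {1..L} \<and> exit_confidence (logits l x) \<ge> \<phi> l" by blast
  from LeastI_ex[OF this] True show ?thesis unfolding stopping_depth_def by simp
next
  case False
  then show ?thesis using assms unfolding stopping_depth_def by simp
qed

text \<open>The depth is the least index at which one of countably many measurable events occurs,
  with default L.\<close>

lemma measurable_stopping_depth:
  assumes "\<And>l. l \<in> {1..L} \<Longrightarrow> logits l \<in> borel_measurable M"
  shows "stopping_depth L \<phi> logits \<in> measurable M (count_space UNIV)"
proof -
  have [measurable]: "Measurable.pred M (\<lambda>x. l \<in> {1..L} \<and> exit_confidence (logits l x) \<ge> \<phi> l)" for l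
  \<comment> \<open>\<open>LEAST\<close> ranges over all naturals, but \<open>logits l\<close> is
    known to be measurable only for layers in range; elsewhere the event is empty.\<close>
  proof (cases "l \<in> {1..L}")
    case True
    then have [measurable]: "logits l \<in> borel_measurable M" by (rule assms)
    show ?thesis by measurable
  next
    case False
    then have "(\<lambda>x. l \<in> {1..L} \<and> exit_confidence (logits l x) \<ge> \<phi> l) = (\<lambda>x. False)" by blast
    then show ?thesis by simp
  qed
  show ?thesis
    unfolding stopping_depth_def Bex_def by measurable
qed

theorem theorem2:
  fixes D :: "'x measure"
    and L :: nat
    and h :: "nat \<Rightarrow> 'x \<Rightarrow> 'h :: {real_normed_vector, second_countable_topology}"
    and hq :: "(nat \<Rightarrow> nat) \<Rightarrow> nat \<Rightarrow> 'x \<Rightarrow> 'h"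
    and logits :: "nat \<Rightarrow> 'x \<Rightarrow> real ^ 'c"
    and b :: "nat \<Rightarrow> nat"
    and \<gamma> :: "nat \<Rightarrow> real"
    and \<epsilon> :: "nat \<Rightarrow> nat \<Rightarrow> real"
    and \<phi> :: "nat \<Rightarrow> real"
  assumes "prob_space D"
    and "L \<ge> 1"
    and "\<And>l. l \<in> {1..L} \<Longrightarrow> h l \<in> borel_measurable D"
    and "\<And>l. l \<in> {1..L} \<Longrightarrow> hq b l \<in> borel_measurable D"
    and "\<And>l. l \<in> {1..L} \<Longrightarrow> logits l \<in> borel_measurable D"
    and "\<And>l. l \<in> {1..L} \<Longrightarrow> \<phi> l \<in> {0..1}"
    and "\<And>l. l \<in> {1..<L} \<Longrightarrow> \<gamma> l \<ge> 0"
    and "\<And>x l. x \<in> space D \<Longrightarrow> l \<in> {1..L} \<Longrightarrow>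
           norm (hq b l x - h l x) \<le> \<gamma> (l - 1) * norm (hq b (l - 1) x - h (l - 1) x) + \<epsilon> l (b l)"
    and "\<And>x. x \<in> space D \<Longrightarrow> norm (hq b 0 x - h 0 x) = 0"
  shows "(\<forall>x\<in>space D. \<forall>k\<in>{1..L}.
            norm (hq b k x - h k x) \<le> (\<Sum>l=1..k. \<epsilon> l (b l) * (\<Prod>r=l+1..k. \<gamma> (r - 1))))
       \<and> (\<integral>x. norm (hq b (stopping_depth L \<phi> logits x) x - h (stopping_depth L \<phi> logits x) x) \<partial>D)
            \<le> (\<integral>x. (\<Sum>l=1..stopping_depth L \<phi> logits x.
                     \<epsilon> l (b l) * (\<Prod>r=l+1..stopping_depth L \<phi> logits x. \<gamma> (r - 1))) \<partial>D)"
proof (intro conjI ballI)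
  interpret prob_space D by fact
  let ?B = "\<lambda>k. \<Sum>l=1..k. \<epsilon> l (b l) * (\<Prod>r=l+1..k. \<gamma> (r - 1))"
  let ?K = "stopping_depth L \<phi> logits"
  have bound: "norm (hq b k x - h k x) \<le> ?B k" if "x \<in> space D" "k \<in> {1..L}" for x k
    using that assms(7-9) by (intro discrete_gronwall) auto
  then show "norm (hq b k x - h k x) \<le> ?B k" if "x \<in> space D" "k \<in> {1..L}" for x k
    using that by blast
  have K: "?K x \<in> {1..L}" for x
    using assms(2) by (rule stopping_depth_in_range)
  have [measurable]: "?K \<in> measurable D (count_space UNIV)"
    using assms(5) by (rule measurable_stopping_depth)
  have "integrable D (\<lambda>x. ?B (?K x))"
  proof (rule integrable_const_bound)
    \<comment> \<open>The depth takes finitely many values, so the largest of the corresponding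
      bounds serves as a constant.\<close>
    show "AE x in D. norm (?B (?K x)) \<le> Max ((\<lambda>k. norm (?B k)) ` {1..L})"
      using K by (intro AE_I2 Max_ge) auto
    show "(\<lambda>x. ?B (?K x)) \<in> borel_measurable D"
      by (rule measurable_compose[where f = ?K and N = "count_space UNIV"]) simp_all
  qed
  then show "(\<integral>x. norm (hq b (?K x) x - h (?K x) x) \<partial>D) \<le> (\<integral>x. ?B (?K x) \<partial>D)"
  \<comment> \<open>This form of monotonicity asks for integrability and nonnegativity of the upper
    function.\<close>
  proof (rule integral_mono')
    fix x assume x: "x \<in> space D"
    show le: "norm (hq b (?K x) x - h (?K x) x) \<le> ?B (?K x)"
      using x K by (rule bound)
    \<comment> \<open>The signs of the \<open>\<epsilon>\<close> terms are not prescribed; the sum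
      is nonnegative because it dominates a norm.\<close>
    show "0 \<le> ?B (?K x)"
      using norm_ge_zero le by (rule order_trans)
  qed
qed

end
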